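(* Let $k\geq 1$ and $n\geq (k+1)^2$ be integers, and let $G$ be a nearly balanced bipartite graph of order $2n-1$. If $\delta(G)\geq k$ and $$q(G)>\frac{n(2n-k-2)+(k+1)^{2}}{n},$$ then $G$ is traceable, unless $G\subseteq C_n^k$.
   Context: All graphs are finite and simple. A bipartite graph with partite sets $X,Y$ is nearly balanced if $|X|=|Y|-1$. $\delta(G)$ is the minimum degree. $q(G)$ is the signless Laplacian spectral radius, i.e. the largest eigenvalue of $Q(G)=D(G)+A(G)$, where $A(G)$ is the adjacency matrix and $D(G)$ the diagonal matrix of vertex degrees. A graph is traceable if it contains a Hamiltonian path. $G\subseteq H$ means that $G$ is (isomorphic to) a subgraph of $H$. Bipartite graphs are taken with fixed ordered partite sets: $K_{a,b}$ is the complete bipartite graph and $O_{a,b}$ the edgeless bipartite graph with first part of size $a$ and second part of size $b$. For bipartite graphs $G_1,G_2$ with bipartitions $(X_1,Y_1)$, $(X_2,Y_2)$, $G_1\sqcup G_2$ is the graph obtained from the disjoint union of $G_1$ and $G_2$ by adding all edges between $X_1$ and $Y_2$ and all edges between $Y_1$ and $X_2$. For $1\leq k\leq n/2$, $C_n^k=O_{k,n-k}\sqcup K_{n-k-1,k}$. *)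

theory Defs
  imports "Graph_Theory.Graph_Theory" "Jordan_Normal_Form.Char_Poly"
begin

text \<open>
  A finite simple graph is a \<^locale>\<open>pair_graph\<close>: an edge \<open>uv\<close> is represented by the two
  arcs \<open>(u,v)\<close> and \<open>(v,u)\<close>, so that the degree of a vertex is its out-degree.
\<close>

definition min_degree :: "'a pair_pre_digraph \<Rightarrow> nat" where
  "min_degree G = Min (out_degree (with_proj G) ` pverts G)"

definition traceable :: "'a pair_pre_digraph \<Rightarrow> bool" where
  "traceable G \<longleftrightarrow>
     (\<exists>u p v. pre_digraph.apath (with_proj G) u p v \<and>
        set (pre_digraph.awalk_verts (with_proj G) u p) = pverts G)"

definition subgraph_up_to_iso :: "'a pair_pre_digraph \<Rightarrow> 'b pair_pre_digraph \<Rightarrow> bool" where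
  "subgraph_up_to_iso G H \<longleftrightarrow>
     (\<exists>H'. subgraph (with_proj H') (with_proj H) \<and> digraph_iso (with_proj G) (with_proj H'))"

text \<open>
  The matrices are taken with respect to an enumeration \<open>f\<close> of the vertices by
  \<open>{0..<card (pverts G)}\<close>. Changing the enumeration conjugates them by a permutation matrix,
  so the eigenvalues do not depend on the one that is chosen below.
\<close>

definition adjacency_mat :: "(nat \<Rightarrow> 'a) \<Rightarrow> 'a pair_pre_digraph \<Rightarrow> real mat" where
  "adjacency_mat f G =
     mat (card (pverts G)) (card (pverts G)) (\<lambda>(i, j). if (f i, f j) \<in> parcs G then 1 else 0)"

definition degree_mat :: "(nat \<Rightarrow> 'a) \<Rightarrow> 'a pair_pre_digraph \<Rightarrow> real mat" where
  "degree_mat f G =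
     mat (card (pverts G)) (card (pverts G))
       (\<lambda>(i, j). if i = j then real (out_degree (with_proj G) (f i)) else 0)"

definition signless_laplacian :: "(nat \<Rightarrow> 'a) \<Rightarrow> 'a pair_pre_digraph \<Rightarrow> real mat" where
  "signless_laplacian f G = degree_mat f G + adjacency_mat f G"

definition vertex_enum :: "'a pair_pre_digraph \<Rightarrow> nat \<Rightarrow> 'a" where
  "vertex_enum G = (SOME f. bij_betw f {0..<card (pverts G)} (pverts G))"

definition signless_laplacian_radius :: "'a pair_pre_digraph \<Rightarrow> real" where
  "signless_laplacian_radius G = Max {x. eigenvalue (signless_laplacian (vertex_enum G) G) x}"

text \<open>An element \<open>(x, y)\<close> of \<open>bedges\<close> is the edge joining \<open>x\<close> in the first part to \<open>y\<close> in the second.\<close>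

record 'a bigraph =
  part1 :: "'a set"
  part2 :: "'a set"
  bedges :: "('a \<times> 'a) set"

definition bipartite_graph :: "'a bigraph \<Rightarrow> bool" where
  "bipartite_graph B \<longleftrightarrow>
     finite (part1 B) \<and> finite (part2 B) \<and> part1 B \<inter> part2 B = {} \<and> bedges B \<subseteq> part1 B \<times> part2 B"

definition graph_of :: "'a bigraph \<Rightarrow> 'a pair_pre_digraph" where
  "graph_of B = \<lparr> pverts = part1 B \<union> part2 B, parcs = bedges B \<union> (bedges B)\<inverse> \<rparr>"

text \<open>\<open>|X| = |Y| - 1\<close>, stated without truncated subtraction.\<close>

definition nearly_balanced :: "'a bigraph \<Rightarrow> bool" where
  "nearly_balanced B \<longleftrightarrow> card (part1 B) + 1 = card (part2 B)"

definition complete_bigraph :: "nat \<Rightarrow> nat \<Rightarrow> nat bigraph" where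
  "complete_bigraph a b =
     \<lparr> part1 = {0..<a}, part2 = {a..<a + b}, bedges = {0..<a} \<times> {a..<a + b} \<rparr>"

definition edgeless_bigraph :: "nat \<Rightarrow> nat \<Rightarrow> nat bigraph" where
  "edgeless_bigraph a b = \<lparr> part1 = {0..<a}, part2 = {a..<a + b}, bedges = {} \<rparr>"

text \<open>
  Edges are oriented from the first part to the second, so an edge between \<open>Y\<^sub>1\<close> and \<open>X\<^sub>2\<close>
  is an element of \<open>X\<^sub>2 \<times> Y\<^sub>1\<close>.
\<close>

definition bijoin :: "'a bigraph \<Rightarrow> 'b bigraph \<Rightarrow> ('a + 'b) bigraph" (infixl "\<squnion>\<^sub>b" 65) where
  "B1 \<squnion>\<^sub>b B2 =
     \<lparr> part1 = part1 B1 <+> part1 B2,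
       part2 = part2 B1 <+> part2 B2,
       bedges = map_prod Inl Inl ` bedges B1 \<union> map_prod Inr Inr ` bedges B2
         \<union> (Inl ` part1 B1) \<times> (Inr ` part2 B2)
         \<union> (Inr ` part1 B2) \<times> (Inl ` part2 B1) \<rparr>"

definition C_graph :: "nat \<Rightarrow> nat \<Rightarrow> (nat + nat) bigraph" where
  "C_graph n k = edgeless_bigraph k (n - k) \<squnion>\<^sub>b complete_bigraph (n - k - 1) k"

lemma pair_graph_graph_of:
  assumes "bipartite_graph B"
  shows "pair_graph (graph_of B)"
proof -
  have "finite (bedges B)"
    using assms finite_subset unfolding bipartite_graph_def by blast
  moreover have "sym (bedges B \<union> (bedges B)\<inverse>)"
    by (auto simp: sym_def)
  ultimately show ?thesis
    using assms unfolding bipartite_graph_def graph_of_def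
    by unfold_locales (auto simp: symmetric_def)
qed

lemma bipartition_graph_of:
  assumes "pair_graph G" "pverts G = X \<union> Y" "X \<inter> Y = {}" "parcs G \<subseteq> X \<times> Y \<union> Y \<times> X"
  defines "B \<equiv> \<lparr> part1 = X, part2 = Y, bedges = parcs G \<inter> X \<times> Y \<rparr>"
  shows "bipartite_graph B" and "graph_of B = G"
proof -
  interpret pair_graph G by fact
  have sym: "(u, v) \<in> parcs G \<Longrightarrow> (v, u) \<in> parcs G" for u v
    using pair_sym_arcs by (auto simp: symmetric_def dest: symD)
  show "bipartite_graph B"
    using assms pair_finite_verts by (auto simp: bipartite_graph_def B_def)
  have "parcs (graph_of B) = parcs G"
    using assms(4) sym by (auto simp: graph_of_def B_def)
  then show "graph_of B = G"
    using assms(2) by (intro pair_pre_digraph.equality) (auto simp: graph_of_def B_def)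
qed

lemma bipartite_graph_C_graph: "bipartite_graph (C_graph n k)"
  by (auto simp: C_graph_def bijoin_def edgeless_bigraph_def complete_bigraph_def
      bipartite_graph_def)

lemma nearly_balanced_C_graph:
  assumes "k < n"
  shows "nearly_balanced (C_graph n k)"
  using assms
  by (auto simp: C_graph_def bijoin_def edgeless_bigraph_def complete_bigraph_def
      nearly_balanced_def card_Plus)

end

theory Submission
  imports Defs
begin

text \<open>
  Write \<open>X\<close>, \<open>Y\<close> for the two parts, so \<open>|X| = n - 1\<close> and \<open>|Y| = n\<close>, and \<open>e\<close> for the number of
  edges. The spectral hypothesis enters only through the bound \<open>q(G) \<le> n + e / n\<close>, which turns it
  into \<open>e > n (n - k - 2) + (k + 1)\<^sup>2\<close>; equivalently, fewer than \<open>(k + 1) (n - k - 1)\<close> of the pairs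
  in \<open>X \<times> Y\<close> are non-edges. The bound holds because, for a vector \<open>d\<close> of positive weights, no
  eigenvalue of a nonnegative matrix \<open>A\<close> exceeds \<open>max\<^sub>i (A d)\<^sub>i / d\<^sub>i\<close>
  (\<open>eigenvalue_le_of_positive_weights\<close>). With the degrees as weights, this quotient for the signless
  Laplacian is the degree of a vertex plus the average degree of its neighbours, and
  \<open>degree_sum_bound\<close> estimates that by counting edges.

  The rest is a closure argument in the style of Bondy and Chvatal. If a Hamiltonian path uses an
  edge \<open>xy\<close> with \<open>d(x) + d(y) \<ge> n\<close>, then a 2-opt move, which reverses a segment of the path,
  replaces \<open>xy\<close> by other edges (\<open>remove_edge_from_path\<close>). Hence an edge-maximal non-traceable \<open>H\<close>
  containing \<open>G\<close> satisfies \<open>d(x) + d(y) \<le> n - 1\<close> for all of its non-edges \<open>xy\<close>. In terms of the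
  bipartite complement \<open>N\<close> of \<open>H\<close>, the end points of each edge of \<open>N\<close> have degree sum at least \<open>n\<close>
  in \<open>N\<close>. But \<open>N\<close> is sparse and has small maximum degrees, and counting edges around the end
  points of a single edge forces \<open>N\<close> to contain all pairs between some \<open>k\<close> vertices of \<open>X\<close> and
  \<open>n - k\<close> vertices of \<open>Y\<close> (\<open>sparse_complement_contains_rectangle\<close>). A graph without edges between
  two such sets is a subgraph of \<open>C\<^sub>n\<^sup>k\<close>.
\<close>

section \<open>Hamiltonian paths and the bipartite closure\<close>

text \<open>
  Since \<open>Y\<close> has one vertex more than \<open>X\<close>, every Hamiltonian path begins and ends in \<open>Y\<close>. Requiring
  this of the head makes the positions of the two parts on the list immediate from the parity.
\<close>

definition spanning_path :: "'a set \<Rightarrow> 'a set \<Rightarrow> ('a \<times> 'a) set \<Rightarrow> 'a list \<Rightarrow> bool" where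
  "spanning_path X Y E p \<longleftrightarrow>
     distinct p \<and> set p = X \<union> Y \<and> hd p \<in> Y \<and> successively (\<lambda>u v. (u, v) \<in> E \<union> E\<inverse>) p"

text \<open>
  The 2-opt move: reversing the segment \<open>p ! i, \<dots>, p ! (l - 1)\<close> affects only the two
  adjacencies at its ends. For \<open>l = length p\<close> there is only the one at its left end.
\<close>

lemma two_opt:
  assumes sym: "symp R"
    and i: "0 < i" "i < l" "l \<le> length p"
    and old: "\<And>t. Suc t < length p \<Longrightarrow> Suc t \<noteq> i \<Longrightarrow> Suc t \<noteq> l \<Longrightarrow> R (p ! t) (p ! Suc t)"
    and left: "R (p ! (i - 1)) (p ! (l - 1))"
    and right: "l < length p \<Longrightarrow> R (p ! i) (p ! l)"
  shows "\<exists>q. successively R q \<and> mset q = mset p \<and> hd q = hd p"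
proof -
  define a b c where "a = take i p" and "b = drop i (take l p)" and "c = drop l p"
  have p: "p = a @ b @ c"
    using i by (metis a_def b_def c_def append_assoc append_take_drop_id less_imp_le min.absorb1
        take_take)
  have ne: "a \<noteq> []" "b \<noteq> []"
    using i by (auto simp: a_def b_def)
  have "successively R a" "successively R b" "successively R c"
    using i by (auto simp: successively_conv_nth a_def b_def c_def intro!: old)
  moreover have "last a = p ! (i - 1)" "last b = p ! (l - 1)" "hd b = p ! i"
    using i ne by (auto simp: a_def b_def last_conv_nth hd_drop_conv_nth min_def)
  moreover have "c \<noteq> [] \<Longrightarrow> l < length p" "c \<noteq> [] \<Longrightarrow> hd c = p ! l"
    using i by (auto simp: c_def hd_drop_conv_nth)
  moreover have "successively R (rev b)"
    using \<open>successively R b\<close> sym by (auto intro: successively_mono dest: sympD)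
  ultimately have "successively R (a @ rev b @ c)"
    using ne left right
    by (cases "c = []") (simp_all add: successively_append_iff hd_append last_rev hd_rev)
  moreover have "mset (a @ rev b @ c) = mset p" "hd (a @ rev b @ c) = hd p"
    using ne by (simp_all add: p)
  ultimately show ?thesis
    by blast
qed

locale near_balanced_parts =
  fixes X Y :: "'a set"
  assumes fin: "finite X" "finite Y" and disj: "X \<inter> Y = {}" and card_Y: "card Y = Suc (card X)"
begin

lemma spanning_path_length:
  assumes "spanning_path X Y E p"
  shows "length p = Suc (2 * card X)"
  using assms distinct_card[of p] card_Un_disjoint[OF fin disj] card_Y
  by (simp add: spanning_path_def)

lemma spanning_path_parity:
  assumes p: "spanning_path X Y E p" and E: "E \<subseteq> X \<times> Y" and "i < length p"
  shows "(even i \<longrightarrow> p ! i \<in> Y) \<and> (odd i \<longrightarrow> p ! i \<in> X)"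
  using \<open>i < length p\<close>
proof (induction i)
  case 0
  then show ?case
    using p by (auto simp: spanning_path_def hd_conv_nth)
next
  case (Suc i)
  then have "(p ! i, p ! Suc i) \<in> E \<union> E\<inverse>"
    using p by (auto simp: spanning_path_def successively_conv_nth)
  then show ?case
    using Suc E disj by auto
qed

lemma spanning_path_bij_Y:
  assumes p: "spanning_path X Y E p" and E: "E \<subseteq> X \<times> Y"
  shows "bij_betw (\<lambda>i. p ! (2 * i)) {..card X} Y"
proof -
  have len: "length p = Suc (2 * card X)" and "distinct p"
    using spanning_path_length p by (auto simp: spanning_path_def)
  then have inj: "inj_on (\<lambda>i. p ! (2 * i)) {..card X}"
    by (auto simp: inj_on_def nth_eq_iff_index_eq)
  have sub: "(\<lambda>i. p ! (2 * i)) ` {..card X} \<subseteq> Y"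
    using spanning_path_parity[OF p E] len by force
  have "(\<lambda>i. p ! (2 * i)) ` {..card X} = Y"
    by (rule card_subset_eq[OF fin(2) sub]) (simp add: card_image[OF inj] card_Y)
  with inj show ?thesis
    by (simp add: bij_betw_def)
qed

lemma spanning_path_bij_X:
  assumes p: "spanning_path X Y E p" and E: "E \<subseteq> X \<times> Y"
  shows "bij_betw (\<lambda>i. p ! Suc (2 * i)) {..<card X} X"
proof -
  have len: "length p = Suc (2 * card X)" and "distinct p"
    using spanning_path_length p by (auto simp: spanning_path_def)
  then have inj: "inj_on (\<lambda>i. p ! Suc (2 * i)) {..<card X}"
    by (auto simp: inj_on_def nth_eq_iff_index_eq)
  have sub: "(\<lambda>i. p ! Suc (2 * i)) ` {..<card X} \<subseteq> X"
    using spanning_path_parity[OF p E] len by force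
  have "(\<lambda>i. p ! Suc (2 * i)) ` {..<card X} = X"
    by (rule card_subset_eq[OF fin(1) sub]) (simp add: card_image[OF inj])
  with inj show ?thesis
    by (simp add: bij_betw_def)
qed

lemma spanning_path_rev:
  assumes p: "spanning_path X Y E p" and E: "E \<subseteq> X \<times> Y"
  shows "spanning_path X Y E (rev p)"
proof -
  have len: "length p = Suc (2 * card X)"
    using spanning_path_length[OF p] .
  then have "last p \<in> Y"
    using spanning_path_parity[OF p E, of "2 * card X"] by (simp add: last_conv_nth flip: length_0_conv)
  moreover have "successively (\<lambda>u v. (v, u) \<in> E \<union> E\<inverse>) p"
    using p by (auto simp: spanning_path_def intro: successively_mono)
  ultimately show ?thesis
    using p by (auto simp: spanning_path_def hd_rev)
qed

text \<open>
  Among the \<open>card X + 1\<close> vertices of \<open>Y\<close> on the path, the degree condition forces one that is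
  adjacent to \<open>x\<close> and either is the end of the path or has a successor adjacent to \<open>y\<close>: otherwise
  the positions of the neighbours of \<open>x\<close> and of the predecessors of the neighbours of \<open>y\<close> would
  be disjoint subsets of the first \<open>card X\<close> positions. Each alternative allows a 2-opt move that
  removes the edge \<open>xy\<close>.
\<close>

lemma remove_edge_from_path:
  assumes H: "H \<subseteq> X \<times> Y" and xy: "x \<in> X" "y \<in> Y"
    and deg: "card (H `` {x}) + card (H\<inverse> `` {y}) \<ge> card Y"
    and ex: "\<exists>p. spanning_path X Y (insert (x, y) H) p"
  shows "\<exists>p. spanning_path X Y H p"
proof -
  let ?H' = "insert (x, y) H"
  define R where "R = (\<lambda>u v. (u, v) \<in> H \<union> H\<inverse>)"
  have H': "?H' \<subseteq> X \<times> Y"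
    using H xy by auto
  have Rsym: "symp R"
    by (auto simp: R_def symp_def)
  obtain p0 where p0: "spanning_path X Y ?H' p0"
    using ex by blast
  show ?thesis
  proof (cases "successively R p0")
    case True
    with p0 show ?thesis
      by (auto simp: spanning_path_def R_def)
  next
    case False
    then obtain t where t: "Suc t < length p0" "\<not> R (p0 ! t) (p0 ! Suc t)"
      by (auto simp: successively_conv_nth)
    moreover have "(p0 ! t, p0 ! Suc t) \<in> ?H' \<union> ?H'\<inverse>"
      using p0 t by (auto simp: spanning_path_def successively_conv_nth)
    ultimately have cases: "p0 ! t = x \<and> p0 ! Suc t = y \<or> p0 ! t = y \<and> p0 ! Suc t = x"
      by (auto simp: R_def)
    have "\<exists>p s. spanning_path X Y ?H' p \<and> Suc s < length p \<and> p ! s = x \<and> p ! Suc s = y"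
    proof (cases "p0 ! t = x \<and> p0 ! Suc t = y")
      case True
      with p0 t show ?thesis by blast
    next
      case False
      with cases have "p0 ! t = y" "p0 ! Suc t = x" by auto
      then have "rev p0 ! (length p0 - Suc (Suc t)) = x"
        "rev p0 ! Suc (length p0 - Suc (Suc t)) = y"
        using t by (auto simp: rev_nth Suc_diff_Suc)
      then show ?thesis
        using spanning_path_rev[OF p0 H'] t
        by (intro exI[of _ "rev p0"] exI[of _ "length p0 - Suc (Suc t)"]) auto
    qed
    then obtain p s where p: "spanning_path X Y ?H' p"
      and s: "Suc s < length p" "p ! s = x" "p ! Suc s = y" by blast
    have dist: "distinct p"
      using p by (simp add: spanning_path_def)
    have len: "length p = Suc (2 * card X)"
      using spanning_path_length[OF p] .
    have "odd s"
      using spanning_path_parity[OF p H', of s] s xy disj by auto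
    then obtain j where j: "s = Suc (2 * j)"
      by (auto elim: oddE)
    have old: "R (p ! t) (p ! Suc t)" if "Suc t < length p" "t \<noteq> s" for t
    proof -
      have "(p ! t, p ! Suc t) \<in> ?H' \<union> ?H'\<inverse>"
        using p that by (auto simp: spanning_path_def successively_conv_nth)
      moreover have "p ! t \<noteq> x"
        using dist that s nth_eq_iff_index_eq[of p t s] by auto
      moreover have "\<not> (p ! t = y \<and> p ! Suc t = x)"
        using dist that s nth_eq_iff_index_eq[of p t "Suc s"] nth_eq_iff_index_eq[of p "Suc t" s]
        by auto
      ultimately show ?thesis
        by (auto simp: R_def)
    qed
    have move: ?thesis
      if "0 < i" "i < l" "l \<le> length p" "i = Suc s \<or> l = Suc s"
        "R (p ! (i - 1)) (p ! (l - 1))" "l < length p \<Longrightarrow> R (p ! i) (p ! l)" for i l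
    proof -
      have "\<exists>q. successively R q \<and> mset q = mset p \<and> hd q = hd p"
        using that old Rsym by (intro two_opt[where i = i and l = l]) auto
      then obtain q where q: "successively R q" "mset q = mset p" "hd q = hd p"
        by blast
      then have "distinct q" "set q = set p"
        using dist mset_eq_imp_distinct_iff mset_eq_setD by blast+
      with q p show ?thesis
        by (auto simp: spanning_path_def R_def)
    qed
    \<comment> \<open>Position \<open>2 i\<close> carries a vertex of \<open>Y\<close>, position \<open>2 i + 1\<close> its successor in \<open>X\<close>; the
      last vertex of the path has index \<open>card X\<close> in this numbering of \<open>Y\<close>.\<close>
    define A where "A = {i \<in> {..card X}. (x, p ! (2 * i)) \<in> H}"
    define B where "B = {i \<in> {..<card X}. (p ! Suc (2 * i), y) \<in> H}"
    have "bij_betw (\<lambda>i. p ! (2 * i)) A (H `` {x})"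
      using spanning_path_bij_Y[OF p H'] H unfolding A_def bij_betw_def inj_on_def
      by (auto simp: image_iff)
    then have cA: "card A = card (H `` {x})"
      by (rule bij_betw_same_card)
    have "bij_betw (\<lambda>i. p ! Suc (2 * i)) B (H\<inverse> `` {y})"
      using spanning_path_bij_X[OF p H'] H unfolding B_def bij_betw_def inj_on_def
      by (auto simp: image_iff)
    then have cB: "card B = card (H\<inverse> `` {y})"
      by (rule bij_betw_same_card)
    have "card X \<in> A \<or> (\<exists>i. i \<in> A \<inter> B)"
    proof (rule ccontr)
      assume *: "\<not> ?thesis"
      then have "A \<union> B \<subseteq> {..<card X}"
        by (auto simp: A_def B_def order.order_iff_strict)
      then have "card (A \<union> B) \<le> card X"
        using card_mono[of "{..<card X}"] by fastforce
      moreover have "card (A \<union> B) = card A + card B"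
        using * by (intro card_Un_disjoint) (auto simp: A_def B_def)
      ultimately show False
        using cA cB deg card_Y by linarith
    qed
    then show ?thesis
    proof (elim disjE exE)
      assume "card X \<in> A"
      then have "R (p ! s) (p ! (length p - 1))"
        using s len by (auto simp: A_def R_def)
      then show ?thesis
        using s by (intro move[of "Suc s" "length p"]) auto
    next
      fix i assume i: "i \<in> A \<inter> B"
      then have il: "Suc (2 * i) < length p" and vx: "R (p ! (2 * i)) x" and sy: "R (p ! Suc (2 * i)) y"
        using len by (auto simp: A_def B_def R_def)
      \<comment> \<open>The segment lies between the two replaced edges: the edge \<open>xy\<close> and the one that
        follows position \<open>2 i\<close>.\<close>
      show ?thesis
      proof (cases "i \<le> j")
        case True
        then show ?thesis
          using s j vx sy by (intro move[of "Suc (2 * i)" "Suc s"]) auto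
      next
        case False
        then show ?thesis
          using s j il sympD[OF Rsym vx] sympD[OF Rsym sy]
          by (intro move[of "Suc s" "Suc (2 * i)"]) auto
      qed
    qed
  qed
qed

lemma spanning_path_complete: "\<exists>p. spanning_path X Y (X \<times> Y) p"
proof -
  obtain xs where xs: "set xs = X" "distinct xs"
    using finite_distinct_list[OF fin(1)] by blast
  obtain ys where ys: "set ys = Y" "distinct ys"
    using finite_distinct_list[OF fin(2)] by blast
  have len: "length ys = Suc (length xs)"
    using xs ys card_Y distinct_card by metis
  have "\<And>us vs. length vs = Suc (length us) \<Longrightarrow> set us \<subseteq> X \<Longrightarrow> set vs \<subseteq> Y \<Longrightarrow>
      successively (\<lambda>u v. (u, v) \<in> X \<times> Y \<union> (X \<times> Y)\<inverse>) (splice vs us) \<and> hd (splice vs us) = hd vs"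
  proof -
    fix us vs :: "'a list"
    show "length vs = Suc (length us) \<Longrightarrow> set us \<subseteq> X \<Longrightarrow> set vs \<subseteq> Y \<Longrightarrow>
      successively (\<lambda>u v. (u, v) \<in> X \<times> Y \<union> (X \<times> Y)\<inverse>) (splice vs us) \<and> hd (splice vs us) = hd vs"
    proof (induction us arbitrary: vs)
      case Nil
      then show ?case
        by (auto simp: length_Suc_conv)
    next
      case (Cons u us)
      then obtain v w ws where vs: "vs = v # w # ws"
        by (auto simp: length_Suc_conv)
      show ?case
        using Cons.IH[of "w # ws"] Cons.prems vs by (auto simp: successively_Cons)
    qed
  qed
  then have "successively (\<lambda>u v. (u, v) \<in> X \<times> Y \<union> (X \<times> Y)\<inverse>) (splice ys xs)"
    "hd (splice ys xs) = hd ys"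
    using len xs ys by blast+
  moreover have "distinct (splice ys xs)" "set (splice ys xs) = X \<union> Y"
    using xs ys disj set_shuffles[OF splice_in_shuffles, of ys xs]
    by (auto intro!: distinct_disjoint_shuffles[OF _ _ _ splice_in_shuffles])
  moreover have "hd ys \<in> Y"
    using ys len by (cases ys) auto
  ultimately show ?thesis
    by (auto simp: spanning_path_def)
qed

lemma edge_maximal_without_spanning_path:
  assumes E: "E \<subseteq> X \<times> Y" and no: "\<nexists>p. spanning_path X Y E p"
  obtains H where "E \<subseteq> H" "H \<subset> X \<times> Y"
    "\<And>x y. (x, y) \<in> X \<times> Y - H \<Longrightarrow> card (H `` {x}) + card (H\<inverse> `` {y}) < card Y"
proof -
  define P where "P = (\<lambda>H. E \<subseteq> H \<and> H \<subseteq> X \<times> Y \<and> (\<nexists>p. spanning_path X Y H p))"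
  have finXY: "finite (X \<times> Y)"
    using fin by simp
  have "P E"
    using E no by (simp add: P_def)
  moreover have "\<forall>H. P H \<longrightarrow> card H < Suc (card (X \<times> Y))"
    using card_mono[OF finXY] by (auto simp: P_def le_imp_less_Suc)
  ultimately obtain H where H: "P H" and max: "\<And>H'. P H' \<Longrightarrow> card H' \<le> card H"
    using ex_has_greatest_nat[of P E card] by blast
  have "card (H `` {x}) + card (H\<inverse> `` {y}) < card Y" if xy: "(x, y) \<in> X \<times> Y - H" for x y
  proof (rule ccontr)
    assume *: "\<not> ?thesis"
    have "\<nexists>p. spanning_path X Y (insert (x, y) H) p"
      using remove_edge_from_path[of H x y] * H xy by (auto simp: P_def)
    then have "P (insert (x, y) H)"
      using H xy by (auto simp: P_def)
    from max[OF this] show False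
      using xy H finite_subset[OF _ finXY] by (auto simp: P_def)
  qed
  moreover have "H \<noteq> X \<times> Y"
    using H spanning_path_complete by (auto simp: P_def)
  ultimately show ?thesis
    using H by (intro that[of H]) (auto simp: P_def)
qed

end

section \<open>The sparse bipartite complement\<close>

lemma sum_card_Image:
  assumes "finite N" "finite A"
  shows "(\<Sum>x\<in>A. card (N `` {x})) = card (N \<inter> A \<times> UNIV)"
proof -
  have "(\<Sum>x\<in>A. card (N `` {x})) = card (SIGMA x:A. N `` {x})"
    using assms by (intro card_SigmaI[symmetric]) (auto intro: finite_Image)
  also have "(SIGMA x:A. N `` {x}) = N \<inter> A \<times> UNIV"
    by auto
  finally show ?thesis .
qed

lemma sum_card_Image_le:
  assumes "finite N"
  shows "(\<Sum>x\<in>A. card (N `` {x})) \<le> card N"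
proof (cases "finite A")
  case True
  then show ?thesis
    using assms by (simp add: sum_card_Image card_mono)
qed simp

text \<open>
  Let \<open>x\<close> be a vertex of degree \<open>a > 0\<close>. Its neighbours have degree at least \<open>n - a\<close> and at most
  \<open>n - k - 1\<close>, so \<open>a > k\<close> and \<open>card N \<ge> a (n - a)\<close>. By concavity the latter excludes all values
  \<open>a\<close> from \<open>k + 1\<close> to \<open>n - k - 1\<close>; hence \<open>a = n - k\<close>. As \<open>card N < (k + 1) (n - k)\<close>, some
  neighbour \<open>y\<close> of \<open>x\<close> has degree only \<open>k\<close>, and then each of its \<open>k\<close> neighbours has degree
  \<open>n - k\<close>. They already account for \<open>k (n - k)\<close> edges, and an edge not meeting them
  would bring at least \<open>n - k - 1\<close> more. So the \<open>k\<close> neighbours of \<open>y\<close> cover all edges, and every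
  vertex in \<open>N `` {x}\<close>, having degree at least \<open>k\<close>, is joined to all of them.
\<close>

lemma sparse_complement_contains_rectangle:
  fixes N :: "('a \<times> 'b) set" and n k :: nat
  assumes fin: "finite N" and ne: "N \<noteq> {}" and k: "2 * k + 1 \<le> n"
    and ore: "\<And>x y. (x, y) \<in> N \<Longrightarrow> n \<le> card (N `` {x}) + card (N\<inverse> `` {y})"
    and dX: "\<And>x. card (N `` {x}) \<le> n - k"
    and dY: "\<And>y. card (N\<inverse> `` {y}) \<le> n - k - 1"
    and sparse: "card N < (k + 1) * (n - k - 1)"
  obtains S T where "S \<times> T \<subseteq> N" "card S = k" "card T = n - k"
proof -
  have finc: "finite (N\<inverse>)" and finI: "finite (N `` A)" "finite (N\<inverse> `` B)" for A B
    using fin by (auto intro: finite_Image)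
  obtain x y0 where xy0: "(x, y0) \<in> N"
    using ne by auto
  define a where "a = card (N `` {x})"
  have lowY: "n - a \<le> card (N\<inverse> `` {y})" if "(x, y) \<in> N" for y
    using ore[OF that] unfolding a_def by linarith
  have "a * (n - a) \<le> (\<Sum>y\<in>N `` {x}. card (N\<inverse> `` {y}))"
    using sum_bounded_below[of "N `` {x}" "n - a" "\<lambda>y. card (N\<inverse> `` {y})"] lowY
    by (auto simp: a_def)
  also have "\<dots> \<le> card N"
    using sum_card_Image_le[OF finc] by (simp add: card_inverse)
  finally have aN: "a * (n - a) \<le> card N" .
  have "n - a \<le> n - k - 1"
    using lowY[OF xy0] dY by (rule order_trans)
  then have ak: "k + 1 \<le> a"
    using k by linarith
  have an: "a \<le> n - k"
    using dX[of x] by (simp add: a_def)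
  have a: "a = n - k"
  proof (rule ccontr)
    assume "a \<noteq> n - k"
    with an have "a \<le> n - k - 1"
      by simp
    \<comment> \<open>With \<open>b = a - (k + 1)\<close> and \<open>c = (n - k - 1) - a\<close>, the product \<open>a (n - a)\<close> is
      the strict upper bound on \<open>card N\<close> plus \<open>b c\<close>.\<close>
    then obtain c where c: "n = a + k + 1 + c"
      using k le_iff_add[of "a + k + 1" n] by auto
    obtain b where b: "a = k + 1 + b"
      using ak le_iff_add by blast
    have "a * (n - a) = (k + 1) * (n - k - 1) + b * c"
      unfolding c b by (simp add: algebra_simps)
    with aN sparse show False
      by linarith
  qed
  have nk: "n - a = k"
    using a k by simp
  have "\<exists>y\<in>N `` {x}. card (N\<inverse> `` {y}) \<le> k"
  proof (rule ccontr)
    assume "\<not> ?thesis"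
    then have "card (N `` {x}) * (k + 1) \<le> (\<Sum>y\<in>N `` {x}. card (N\<inverse> `` {y}))"
      using sum_bounded_below[of "N `` {x}" "k + 1" "\<lambda>y. card (N\<inverse> `` {y})"] by force
    also have "\<dots> \<le> card N"
      using sum_card_Image_le[OF finc] by (simp add: card_inverse)
    finally have "(k + 1) * (n - k) \<le> card N"
      by (simp add: a[unfolded a_def] mult.commute)
    moreover have "(k + 1) * (n - k - 1) \<le> (k + 1) * (n - k)"
      by (intro mult_le_mono) auto
    ultimately show False
      using sparse by linarith
  qed
  then obtain y where y: "(x, y) \<in> N" "card (N\<inverse> `` {y}) \<le> k"
    by auto
  define F where "F = N\<inverse> `` {y}"
  have F: "card F = k" "finite F"
    using lowY[OF y(1)] y(2) nk finI by (auto simp: F_def)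
  have xF: "x \<in> F"
    using y by (auto simp: F_def)
  have dF: "card (N `` {x'}) = n - k" if "x' \<in> F" for x'
    using ore[of x' y] that dX[of x'] F k by (auto simp: F_def)
  have cF: "card (N \<inter> F \<times> UNIV) = k * (n - k)"
    using sum_card_Image[OF fin F(2)] dF F(1) by simp
  have cover: "u \<in> F" if uv: "(u, v) \<in> N" for u v
  proof (rule ccontr)
    assume u: "u \<notin> F"
    \<comment> \<open>Disjoint sets of edges at \<open>F\<close>, at \<open>u\<close>, and at \<open>v\<close>; the edge \<open>uv\<close> is counted at \<open>u\<close>.\<close>
    let ?P = "N \<inter> F \<times> UNIV" and ?Q = "{u} \<times> N `` {u}" and ?R = "(N\<inverse> `` {v} - F - {u}) \<times> {v}"
    have fins: "finite ?P" "finite ?Q" "finite ?R"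
      using fin finI by auto
    have "?P \<inter> (?Q \<union> ?R) = {}" "?Q \<inter> ?R = {}"
      using u by auto
    with fins have "card ?P + (card ?Q + card ?R) = card (?P \<union> (?Q \<union> ?R))"
      by (simp add: card_Un_disjoint)
    also have "\<dots> \<le> card N"
      using fin by (intro card_mono) auto
    finally have "k * (n - k) + (card (N `` {u}) + card (N\<inverse> `` {v} - F - {u})) \<le> card N"
      by (simp add: cF card_cartesian_product)
    moreover have "card (N\<inverse> `` {v}) \<le> card (N\<inverse> `` {v} - F - {u}) + k + 1"
    proof -
      have "N\<inverse> `` {v} \<subseteq> (N\<inverse> `` {v} - F - {u}) \<union> insert u F"
        by auto
      then have "card (N\<inverse> `` {v}) \<le> card ((N\<inverse> `` {v} - F - {u}) \<union> insert u F)"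
        using finI F by (intro card_mono) auto
      also have "\<dots> \<le> card (N\<inverse> `` {v} - F - {u}) + card (insert u F)"
        by (rule card_Un_le)
      finally show ?thesis
        using F u by simp
    qed
    ultimately have "k * (n - k) + (n - k - 1) \<le> card N"
      using ore[OF uv] by linarith
    moreover have "k * (n - k - 1) \<le> k * (n - k)"
      by (intro mult_le_mono) auto
    then have "(k + 1) * (n - k - 1) \<le> k * (n - k) + (n - k - 1)"
      by (simp add: add_mult_distrib)
    ultimately show False
      using sparse by linarith
  qed
  have "F \<times> N `` {x} \<subseteq> N"
  proof safe
    fix u v assume u: "u \<in> F" and v: "(x, v) \<in> N"
    have "N\<inverse> `` {v} \<subseteq> F"
      using cover by auto
    moreover have "card F \<le> card (N\<inverse> `` {v})"
      using lowY[OF v] nk F by simp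
    ultimately have "N\<inverse> `` {v} = F"
      using F card_seteq by blast
    with u show "(u, v) \<in> N"
      by auto
  qed
  then show ?thesis
    using F(1) dF[OF xF] by (rule that)
qed

text \<open>
  The edge-maximal graph \<open>H\<close> from the closure argument contains \<open>E\<close>, so it inherits the degree
  condition and the density, and its bipartite complement satisfies the hypotheses of the
  previous lemma.
\<close>

lemma (in near_balanced_parts) spanning_path_or_empty_rectangle:
  assumes E: "E \<subseteq> X \<times> Y" and n: "card Y = n" "2 * k + 1 \<le> n" and k: "0 < k"
    and dX: "\<And>x. x \<in> X \<Longrightarrow> k \<le> card (E `` {x})"
    and dY: "\<And>y. y \<in> Y \<Longrightarrow> k \<le> card (E\<inverse> `` {y})"
    and dense: "card X * card Y < card E + (k + 1) * (n - k - 1)"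
  shows "(\<exists>p. spanning_path X Y E p) \<or>
    (\<exists>S T. S \<subseteq> X \<and> T \<subseteq> Y \<and> card S = k \<and> card T = n - k \<and> E \<inter> S \<times> T = {})"
proof (rule disjCI)
  assume no: "\<nexists>S T. S \<subseteq> X \<and> T \<subseteq> Y \<and> card S = k \<and> card T = n - k \<and> E \<inter> S \<times> T = {}"
  show "\<exists>p. spanning_path X Y E p"
  proof (rule ccontr)
    assume "\<not> ?thesis"
    then obtain H where H: "E \<subseteq> H" "H \<subset> X \<times> Y"
      and ore: "\<And>x y. (x, y) \<in> X \<times> Y - H \<Longrightarrow> card (H `` {x}) + card (H\<inverse> `` {y}) < card Y"
      using edge_maximal_without_spanning_path[OF E] by blast
    define N where "N = X \<times> Y - H"
    have finH: "finite H"
      using H fin finite_subset[of H "X \<times> Y"] by auto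
    then have finE: "finite E"
      using H finite_subset by blast
    have NX: "card (N `` {x}) = n - card (H `` {x})" if "x \<in> X" for x
    proof -
      have "N `` {x} = Y - H `` {x}"
        using that by (auto simp: N_def)
      moreover have "H `` {x} \<subseteq> Y"
        using H by auto
      ultimately show ?thesis
        using n fin finite_subset by (metis card_Diff_subset)
    qed
    have NY: "card (N\<inverse> `` {y}) = n - 1 - card (H\<inverse> `` {y})" if "y \<in> Y" for y
    proof -
      have "N\<inverse> `` {y} = X - H\<inverse> `` {y}"
        using that by (auto simp: N_def)
      moreover have "H\<inverse> `` {y} \<subseteq> X"
        using H by auto
      ultimately show ?thesis
        using n fin finite_subset card_Y by (metis card_Diff_subset diff_Suc_1)
    qed
    have HX: "k \<le> card (H `` {x})" if "x \<in> X" for x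
      using dX[OF that] card_mono[of "H `` {x}" "E `` {x}"] finH H
      by (meson Image_mono finite_Image order_refl order_trans)
    have HY: "k \<le> card (H\<inverse> `` {y})" if "y \<in> Y" for y
      using dY[OF that] card_mono[of "H\<inverse> `` {y}" "E\<inverse> `` {y}"] finH H
      by (meson Image_mono converse_mono finite_Image finite_converse order_refl order_trans)
    have 1: "finite N" "N \<noteq> {}"
      using fin H by (auto simp: N_def)
    have 2: "n \<le> card (N `` {x}) + card (N\<inverse> `` {y})" if "(x, y) \<in> N" for x y
      using ore[of x y] that NX[of x] NY[of y] n by (auto simp: N_def)
    have 3: "card (N `` {x}) \<le> n - k" for x
    proof (cases "x \<in> X")
      case True
      then show ?thesis using NX HX by (simp add: diff_le_mono2)
    next
      case False
      then have "N `` {x} = {}" by (auto simp: N_def)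
      then show ?thesis by simp
    qed
    have 4: "card (N\<inverse> `` {y}) \<le> n - k - 1" for y
    proof (cases "y \<in> Y")
      case True
      then show ?thesis using NY[of y] HY[of y] by simp
    next
      case False
      then have "N\<inverse> `` {y} = {}" by (auto simp: N_def)
      then show ?thesis by simp
    qed
    have "card N = card X * card Y - card H" "card E \<le> card H" "card H \<le> card X * card Y"
      using H finH fin card_mono[of "X \<times> Y" H]
      by (auto simp: N_def card_Diff_subset card_cartesian_product intro: card_mono)
    then have 5: "card N < (k + 1) * (n - k - 1)"
      using dense by linarith
    obtain S T where ST: "S \<times> T \<subseteq> N" "card S = k" "card T = n - k"
      using sparse_complement_contains_rectangle[OF 1 n(2) 2 3 4 5] by blast
    moreover have "S \<noteq> {}" "T \<noteq> {}"
      using ST n k by auto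
    ultimately have "S \<subseteq> X" "T \<subseteq> Y" "E \<inter> S \<times> T = {}"
      using H by (auto simp: N_def)
    with ST no show False
      by blast
  qed
qed

section \<open>The spectral bound\<close>

text \<open>
  Compare an eigenvector \<open>v\<close> with \<open>d\<close> in the coordinate \<open>i\<close> where \<open>\<bar>v\<^sub>i\<bar> / d\<^sub>i\<close> is largest.
\<close>

lemma eigenvalue_le_of_positive_weights:
  fixes A :: "real mat"
  assumes A: "A \<in> carrier_mat m m"
    and nonneg: "\<And>i j. i < m \<Longrightarrow> j < m \<Longrightarrow> 0 \<le> A $$ (i, j)"
    and d: "\<And>i. i < m \<Longrightarrow> 0 < d i"
    and bound: "\<And>i. i < m \<Longrightarrow> (\<Sum>j\<in>{0..<m}. A $$ (i, j) * d j) \<le> c * d i"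
    and ev: "eigenvalue A r"
  shows "r \<le> c"
proof -
  obtain v where v: "v \<in> carrier_vec m" "v \<noteq> 0\<^sub>v m" "A *\<^sub>v v = r \<cdot>\<^sub>v v"
    using ev A by (auto simp: eigenvalue_def eigenvector_def)
  obtain l where l: "l < m" "v $ l \<noteq> 0"
    using v by (metis carrier_vecD eq_vecI index_zero_vec)
  define t where "t = Max ((\<lambda>i. \<bar>v $ i\<bar> / d i) ` {0..<m})"
  have "t \<in> (\<lambda>i. \<bar>v $ i\<bar> / d i) ` {0..<m}"
    unfolding t_def using l by (intro Max_in) auto
  then obtain i where i: "i < m" "t = \<bar>v $ i\<bar> / d i"
    by auto
  have tj: "\<bar>v $ j\<bar> \<le> t * d j" if "j < m" for j
  proof -
    have "\<bar>v $ j\<bar> / d j \<le> t"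
      unfolding t_def using that by (intro Max_ge) auto
    then show ?thesis
      using d[OF that] by (simp add: divide_simps)
  qed
  have "0 < t * d l"
    using tj[OF l(1)] l(2) by linarith
  then have t: "0 < t"
    using d[OF l(1)] zero_less_mult_pos2 by blast
  have "r * v $ i = (A *\<^sub>v v) $ i"
    using v i by simp
  also have "\<dots> = (\<Sum>j\<in>{0..<m}. A $$ (i, j) * v $ j)"
    using A v(1) i by (auto simp: scalar_prod_def)
  finally have "\<bar>r * v $ i\<bar> \<le> (\<Sum>j\<in>{0..<m}. \<bar>A $$ (i, j) * v $ j\<bar>)"
    by simp
  also have "\<dots> \<le> (\<Sum>j\<in>{0..<m}. t * (A $$ (i, j) * d j))"
  proof (rule sum_mono)
    fix j assume "j \<in> {0..<m}"
    then have "A $$ (i, j) * \<bar>v $ j\<bar> \<le> A $$ (i, j) * (t * d j)" "0 \<le> A $$ (i, j)"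
      using nonneg i(1) tj by (auto intro: mult_left_mono)
    then show "\<bar>A $$ (i, j) * v $ j\<bar> \<le> t * (A $$ (i, j) * d j)"
      by (simp add: abs_mult mult.left_commute)
  qed
  also have "\<dots> = t * (\<Sum>j\<in>{0..<m}. A $$ (i, j) * d j)"
    by (simp add: sum_distrib_left)
  also have "\<dots> \<le> t * (c * d i)"
    using bound[OF i(1)] t by simp
  also have "\<bar>r * v $ i\<bar> = \<bar>r\<bar> * (t * d i)"
    using i d[OF i(1)] by (simp add: abs_mult)
  finally have "\<bar>r\<bar> * (t * d i) \<le> c * (t * d i)"
    by (simp add: algebra_simps)
  moreover have "0 < t * d i"
    using t d[OF i(1)] by simp
  ultimately have "\<bar>r\<bar> \<le> c"
    using mult_le_cancel_right_pos by blast
  then show ?thesis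
    by linarith
qed

text \<open>
  Write \<open>d\<close> for the degree of \<open>x\<close> and \<open>s\<close> for the sum of the degrees of its neighbours. Then
  \<open>s \<le> card E\<close> and \<open>s \<le> n d\<close>, and the two sides differ by
  \<open>d (card E - s) + (n - d) (n d - s)\<close>. Division by \<open>n d\<close> gives \<open>d + s / d \<le> n + card E / n\<close>.
\<close>

lemma degree_sum_bound:
  fixes E :: "('a \<times> 'b) set" and n :: nat
  assumes fin: "finite E" and d: "card (E `` {x}) \<le> n" and dY: "\<And>y. card (E\<inverse> `` {y}) \<le> n"
  shows "n * (card (E `` {x}) * card (E `` {x}) + (\<Sum>y\<in>E `` {x}. card (E\<inverse> `` {y})))
    \<le> (n * n + card E) * card (E `` {x})"
proof -
  define s where "s = (\<Sum>y\<in>E `` {x}. card (E\<inverse> `` {y}))"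
  define d where "d = card (E `` {x})"
  obtain c where c: "n = d + c"
    using assms(2) le_iff_add unfolding d_def by blast
  have "s \<le> card E"
    using sum_card_Image_le[of "E\<inverse>" "E `` {x}"] fin by (simp add: s_def card_inverse)
  then have 1: "d * s \<le> d * card E"
    by simp
  have "s \<le> d * n"
    unfolding s_def d_def using sum_bounded_above[of "E `` {x}" _ n] dY by auto
  then have 2: "c * s \<le> c * (d * n)"
    by simp
  have "n * (d * d + s) = n * (d * d) + c * s + d * s"
    "(n * n + card E) * d = n * (d * d) + c * (d * n) + d * card E"
    by (simp_all add: c algebra_simps)
  then have "n * (d * d + s) \<le> (n * n + card E) * d"
    using 1 2 by linarith
  then show ?thesis
    by (simp add: s_def d_def)
qed

lemma out_degree_with_proj: "out_degree (with_proj G) v = card (parcs G `` {v})"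
proof -
  have "out_arcs (with_proj G) v = Pair v ` (parcs G `` {v})"
    by (auto simp: out_arcs_def)
  then show ?thesis
    by (simp add: out_degree_def card_image inj_on_def)
qed

lemma signless_laplacian_row_sum:
  assumes G: "pair_graph G" and f: "bij_betw f {0..<card (pverts G)} (pverts G)"
    and i: "i < card (pverts G)"
  shows "(\<Sum>j\<in>{0..<card (pverts G)}. signless_laplacian f G $$ (i, j) * g (f j)) =
    real (card (parcs G `` {f i})) * g (f i) + (\<Sum>w\<in>parcs G `` {f i}. g w)"
proof -
  interpret pair_graph G by fact
  let ?I = "{0..<card (pverts G)}"
  have "(\<Sum>j\<in>?I. signless_laplacian f G $$ (i, j) * g (f j)) =
    (\<Sum>j\<in>?I. (if i = j then real (card (parcs G `` {f i})) * g (f i) else 0) +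
      (if f j \<in> parcs G `` {f i} then g (f j) else 0))"
    using i by (intro sum.cong)
      (auto simp: signless_laplacian_def degree_mat_def adjacency_mat_def out_degree_with_proj
        algebra_simps)
  also have "\<dots> = real (card (parcs G `` {f i})) * g (f i) +
      (\<Sum>j\<in>?I. if f j \<in> parcs G `` {f i} then g (f j) else 0)"
    using i by (simp add: sum.distrib)
  also have "(\<Sum>j\<in>?I. if f j \<in> parcs G `` {f i} then g (f j) else 0) =
      (\<Sum>w\<in>pverts G. if w \<in> parcs G `` {f i} then g w else 0)"
    by (rule sum.reindex_bij_betw[OF f])
  also have "\<dots> = (\<Sum>w\<in>pverts G \<inter> parcs G `` {f i}. g w)"
    using pair_finite_verts by (simp add: sum.inter_restrict)
  also have "pverts G \<inter> parcs G `` {f i} = parcs G `` {f i}"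
    by (auto dest: arc_snd_in_verts)
  finally show ?thesis .
qed

text \<open>
  The maximum in the definition of the radius is an eigenvalue because there is a real eigenvalue at
  all: the vector that is \<open>1\<close> on one part and \<open>-1\<close> on the other is in the kernel.
\<close>

lemma eigenvalue_signless_laplacian_radius:
  fixes B :: "'a bigraph"
  assumes B: "bipartite_graph B" and ne: "pverts (graph_of B) \<noteq> {}"
  shows "eigenvalue (signless_laplacian (vertex_enum (graph_of B)) (graph_of B))
    (signless_laplacian_radius (graph_of B))"
proof -
  define G where "G = graph_of B"
  define m where "m = card (pverts G)"
  define f where "f = vertex_enum G"
  define Q where "Q = signless_laplacian f G"
  interpret pair_graph G
    unfolding G_def by (rule pair_graph_graph_of[OF B])
  have f: "bij_betw f {0..<m} (pverts G)"
    unfolding f_def vertex_enum_def m_def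
    using someI_ex[OF ex_bij_betw_nat_finite[OF pair_finite_verts]] .
  have m: "0 < m"
    using ne pair_finite_verts by (simp add: m_def G_def card_gt_0_iff)
  have Q: "Q \<in> carrier_mat m m"
    by (simp add: Q_def m_def signless_laplacian_def degree_mat_def adjacency_mat_def)
  define g where "g = (\<lambda>w. if w \<in> part1 B then 1 else - 1 :: real)"
  define v where "v = vec m (\<lambda>j. g (f j))"
  have "eigenvector Q v 0"
  proof -
    have "Q *\<^sub>v v = 0 \<cdot>\<^sub>v v"
    proof (rule eq_vecI)
      fix i assume "i < dim_vec (0 \<cdot>\<^sub>v v)"
      then have i: "i < m"
        by (simp add: v_def)
      have "(Q *\<^sub>v v) $ i = (\<Sum>j\<in>{0..<m}. Q $$ (i, j) * g (f j))"
        using Q i by (auto simp: scalar_prod_def v_def)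
      also have "\<dots> = real (card (parcs G `` {f i})) * g (f i) + (\<Sum>w\<in>parcs G `` {f i}. g w)"
        unfolding Q_def m_def
        by (rule signless_laplacian_row_sum) (use f i pair_graph in \<open>auto simp: m_def\<close>)
      also have "(\<Sum>w\<in>parcs G `` {f i}. g w) = (\<Sum>w\<in>parcs G `` {f i}. - g (f i))"
        using B by (intro sum.cong) (auto simp: g_def G_def graph_of_def bipartite_graph_def)
      finally show "(Q *\<^sub>v v) $ i = (0 \<cdot>\<^sub>v v) $ i"
        using i by (simp add: v_def)
    qed (use Q in \<open>auto simp: v_def\<close>)
    moreover have "v $ 0 \<noteq> 0\<^sub>v m $ 0"
      using m by (simp add: v_def g_def)
    then have "v \<noteq> 0\<^sub>v m"
      by metis
    ultimately show ?thesis
      using Q by (auto simp: eigenvector_def v_def)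
  qed
  then have "{x. eigenvalue Q x} \<noteq> {}"
    by (auto simp: eigenvalue_def)
  moreover have "char_poly Q \<noteq> 0"
    using degree_monic_char_poly[OF Q] by auto
  then have "finite {x. eigenvalue Q x}"
    using eigenvalue_root_char_poly[OF Q] poly_roots_finite by simp
  ultimately have "Max {x. eigenvalue Q x} \<in> {x. eigenvalue Q x}"
    by (intro Max_in)
  then show ?thesis
    by (simp add: signless_laplacian_radius_def Q_def f_def G_def)
qed

lemma signless_laplacian_radius_bipartite_le:
  fixes B :: "'a bigraph" and n :: nat
  assumes B: "bipartite_graph B" and n: "card (part1 B) \<le> n" "card (part2 B) \<le> n"
    and ne: "pverts (graph_of B) \<noteq> {}"
    and pos: "\<And>v. v \<in> pverts (graph_of B) \<Longrightarrow> 0 < card (parcs (graph_of B) `` {v})"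
  shows "signless_laplacian_radius (graph_of B) \<le> real n + real (card (bedges B)) / real n"
proof -
  define G where "G = graph_of B"
  define E where "E = bedges B"
  define m where "m = card (pverts G)"
  define f where "f = vertex_enum G"
  define deg where "deg = (\<lambda>v. card (parcs G `` {v}))"
  interpret pair_graph G
    unfolding G_def by (rule pair_graph_graph_of[OF B])
  have f: "bij_betw f {0..<m} (pverts G)"
    unfolding f_def vertex_enum_def m_def
    using someI_ex[OF ex_bij_betw_nat_finite[OF pair_finite_verts]] .
  have EB: "E \<subseteq> part1 B \<times> part2 B" and finp: "finite (part1 B)" "finite (part2 B)"
    and disj: "part1 B \<inter> part2 B = {}"
    using B by (auto simp: bipartite_graph_def E_def)
  have finE: "finite E"
    using EB finp finite_subset by blast
  have V: "pverts G = part1 B \<union> part2 B"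
    by (simp add: G_def graph_of_def)
  have N1: "parcs G `` {x} = E `` {x}" if "x \<in> part1 B" for x
    using that EB disj by (auto simp: G_def graph_of_def E_def)
  have N2: "parcs G `` {y} = E\<inverse> `` {y}" if "y \<in> part2 B" for y
    using that EB disj by (auto simp: G_def graph_of_def E_def)
  have d1: "card (E `` {x}) \<le> n" for x
  proof -
    have "E `` {x} \<subseteq> part2 B"
      using EB by blast
    from card_mono[OF finp(2) this] n(2) show ?thesis
      by (rule order_trans)
  qed
  have d2: "card (E\<inverse> `` {y}) \<le> n" for y
  proof -
    have "E\<inverse> `` {y} \<subseteq> part1 B"
      using EB by blast
    from card_mono[OF finp(1) this] n(1) show ?thesis
      by (rule order_trans)
  qed
  have n0: "0 < n"
  proof (rule ccontr)
    assume "\<not> 0 < n"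
    then have "part1 B = {}" "part2 B = {}"
      using n finp by simp_all
    then show False
      using ne V by (simp add: G_def)
  qed
  have key: "n * (deg v * deg v + (\<Sum>w\<in>parcs G `` {v}. deg w)) \<le> (n * n + card E) * deg v"
    if "v \<in> pverts G" for v
  proof (cases "v \<in> part1 B")
    case True
    have "(\<Sum>w\<in>parcs G `` {v}. deg w) = (\<Sum>w\<in>E `` {v}. card (E\<inverse> `` {w}))"
      unfolding N1[OF True] deg_def using EB N2 by (intro sum.cong) auto
    then show ?thesis
      using degree_sum_bound[OF finE d1 d2, of v] by (simp add: deg_def N1[OF True])
  next
    case False
    then have v: "v \<in> part2 B"
      using that V by simp
    have "(\<Sum>w\<in>parcs G `` {v}. deg w) = (\<Sum>w\<in>E\<inverse> `` {v}. card (E `` {w}))"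
      unfolding N2[OF v] deg_def using EB N1 by (intro sum.cong) auto
    then show ?thesis
      using degree_sum_bound[of "E\<inverse>" v n] finE d1 d2
      by (simp add: deg_def N2[OF v] card_inverse)
  qed
  show ?thesis
  proof (rule eigenvalue_le_of_positive_weights[where m = m and d = "\<lambda>i. real (deg (f i))"])
    show "signless_laplacian f G \<in> carrier_mat m m"
      by (simp add: m_def signless_laplacian_def degree_mat_def adjacency_mat_def)
    show "eigenvalue (signless_laplacian f G) (signless_laplacian_radius (graph_of B))"
      unfolding f_def G_def by (rule eigenvalue_signless_laplacian_radius[OF B ne])
    show "0 \<le> signless_laplacian f G $$ (i, j)" if "i < m" "j < m" for i j
      using that by (simp add: m_def signless_laplacian_def degree_mat_def adjacency_mat_def)
    show "0 < real (deg (f i))" if "i < m" for i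
      using pos[of "f i"] bij_betwE[OF f] that by (simp add: deg_def G_def)
    show "(\<Sum>j\<in>{0..<m}. signless_laplacian f G $$ (i, j) * real (deg (f j)))
      \<le> (real n + real (card (bedges B)) / real n) * real (deg (f i))" if i: "i < m" for i
    proof -
      have "f i \<in> pverts G"
        using bij_betwE[OF f] i by simp
      then have "real (n * (deg (f i) * deg (f i) + (\<Sum>w\<in>parcs G `` {f i}. deg w)))
          \<le> real ((n * n + card E) * deg (f i))"
        using key of_nat_mono by blast
      then have "real (deg (f i)) * real (deg (f i)) + (\<Sum>w\<in>parcs G `` {f i}. real (deg w))
        \<le> (real n + real (card E) / real n) * real (deg (f i))"
        using n0 by (simp add: field_simps)
      moreover have "(\<Sum>j\<in>{0..<m}. signless_laplacian f G $$ (i, j) * real (deg (f j))) =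
          real (deg (f i)) * real (deg (f i)) + (\<Sum>w\<in>parcs G `` {f i}. real (deg w))"
        unfolding m_def using f i pair_graph
        by (subst signless_laplacian_row_sum[where g = "\<lambda>w. real (deg w)"])
          (auto simp: m_def deg_def)
      ultimately show ?thesis
        by (simp add: E_def)
    qed
  qed
qed

section \<open>Transfer to digraphs\<close>

lemma traceable_if_spanning_path:
  assumes p: "spanning_path (part1 B) (part2 B) (bedges B) p"
  shows "traceable (graph_of B)"
proof -
  let ?G = "with_proj (graph_of B)"
  have walk: "set (zip p (tl p)) \<subseteq> parcs G \<and> pre_digraph.cas (with_proj G) (hd p) (zip p (tl p)) (last p)
      \<and> pre_digraph.awalk_verts (with_proj G) (hd p) (zip p (tl p)) = p"
    if "successively (\<lambda>u v. (u, v) \<in> parcs G) p" "p \<noteq> []" for p and G :: "'b pair_pre_digraph"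
    using that
    by (induction p rule: induct_list012)
      (auto simp: pre_digraph.cas.simps pre_digraph.awalk_verts.simps
        simp del: cas_with_proj_eq awalk_verts_with_proj_eq)
  have "successively (\<lambda>u v. (u, v) \<in> parcs (graph_of B)) p" "distinct p"
    "set p = pverts (graph_of B)" "p \<noteq> []"
    using p by (auto simp: spanning_path_def graph_of_def)
  then show ?thesis
    using walk[of "graph_of B" p] hd_in_set[of p]
    unfolding traceable_def pre_digraph.apath_def pre_digraph.awalk_def
    by (intro exI[of _ "hd p"] exI[of _ "zip p (tl p)"] exI[of _ "last p"]) auto
qed

lemma subgraph_up_to_iso_if_embedding:
  assumes G: "pair_graph G" and H: "pair_graph H" and inj: "inj_on h (pverts G)"
    and verts: "h ` pverts G \<subseteq> pverts H"
    and arcs: "\<And>u v. (u, v) \<in> parcs G \<Longrightarrow> (h u, h v) \<in> parcs H"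
  shows "subgraph_up_to_iso G H"
proof -
  interpret G: pair_graph G by fact
  interpret H: pair_graph H by fact
  define H' where "H' = \<lparr> pverts = h ` pverts G, parcs = map_prod h h ` parcs G \<rparr>"
  define \<phi> where
    "\<phi> = \<lparr> iso_verts = h, iso_arcs = map_prod h h, iso_head = snd, iso_tail = fst \<rparr>"
  have "pair_wf_digraph H'"
    by unfold_locales (auto simp: H'_def dest: G.arc_fst_in_verts G.arc_snd_in_verts)
  then have "subgraph (with_proj H') (with_proj H)"
    using verts arcs H.wf_digraph_axioms
    by (auto simp: subgraph_def compatible_def H'_def wf_digraph_wp_iff)
  moreover have "inj_on (map_prod h h) (parcs G)"
    by (intro map_prod_inj_on[OF inj inj, THEN inj_on_subset])
      (auto dest: G.arc_fst_in_verts G.arc_snd_in_verts)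
  then have "pre_digraph.digraph_isomorphism (with_proj G) \<phi>"
    using inj G.wf_digraph_axioms by (auto simp: pre_digraph.digraph_isomorphism_def \<phi>_def)
  moreover have "with_proj H' = app_iso \<phi> (with_proj G)"
    by (simp add: app_iso_def \<phi>_def H'_def with_proj_def)
  ultimately show ?thesis
    unfolding subgraph_up_to_iso_def digraph_iso_def by blast
qed

text \<open>
  In \<open>C\<^sub>n\<^sup>k\<close> the only pairs missing between the two parts are those inside the edgeless summand, so
  sending \<open>S\<close> and \<open>T\<close> to its parts and the other vertices to the complete summand preserves edges.
\<close>

lemma subgraph_of_C_graph:
  fixes B :: "'a bigraph"
  assumes B: "bipartite_graph B" and X: "card (part1 B) = n - 1" and Y: "card (part2 B) = n"
    and S: "S \<subseteq> part1 B" "card S = k" and T: "T \<subseteq> part2 B" "card T = n - k" and k: "k < n"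
    and ST: "bedges B \<inter> S \<times> T = {}"
  shows "subgraph_up_to_iso (graph_of B) (graph_of (C_graph n k))"
proof -
  have fin: "finite (part1 B)" "finite (part2 B)" and disj: "part1 B \<inter> part2 B = {}"
    and E: "bedges B \<subseteq> part1 B \<times> part2 B"
    using B by (auto simp: bipartite_graph_def)
  have finST: "finite S" "finite T"
    using S T fin finite_subset by blast+
  have "card (part1 B - S) = n - k - 1" "card (part2 B - T) = k"
    using S T X Y k finST by (auto simp: card_Diff_subset)
  then obtain a b c d where
    a: "bij_betw a S {0..<k}" and b: "bij_betw b T {k..<n}" and
    c: "bij_betw c (part1 B - S) {0..<n - k - 1}" and
    d: "bij_betw d (part2 B - T) {n - k - 1..<n - k - 1 + k}"
    using finite_same_card_bij[of S "{0..<k}"] finite_same_card_bij[of T "{k..<n}"]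
      finite_same_card_bij[of "part1 B - S" "{0..<n - k - 1}"]
      finite_same_card_bij[of "part2 B - T" "{n - k - 1..<n - k - 1 + k}"] finST fin S T by auto
  define h where "h = (\<lambda>v. if v \<in> S then Inl (a v) else if v \<in> T then Inl (b v)
    else if v \<in> part1 B then Inr (c v) else Inr (d v))"
  have Inl: "bij_betw h A (Inl ` C)" if "bij_betw g A C" "\<And>v. v \<in> A \<Longrightarrow> h v = Inl (g v)" for g A C
    using that by (auto simp: bij_betw_def inj_on_def image_iff)
  have Inr: "bij_betw h A (Inr ` C)" if "bij_betw g A C" "\<And>v. v \<in> A \<Longrightarrow> h v = Inr (g v)" for g A C
    using that by (auto simp: bij_betw_def inj_on_def image_iff)
  have hS: "bij_betw h S (Inl ` {0..<k})"
    by (rule Inl[OF a]) (simp add: h_def)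
  have hT: "bij_betw h T (Inl ` {k..<n})"
    by (rule Inl[OF b]) (use S T disj in \<open>auto simp: h_def\<close>)
  have hX: "bij_betw h (part1 B - S) (Inr ` {0..<n - k - 1})"
    by (rule Inr[OF c]) (use S T disj in \<open>auto simp: h_def\<close>)
  have hY: "bij_betw h (part2 B - T) (Inr ` {n - k - 1..<n - k - 1 + k})"
    by (rule Inr[OF d]) (use S T disj in \<open>auto simp: h_def\<close>)
  have "bij_betw h ((S \<union> T) \<union> ((part1 B - S) \<union> (part2 B - T)))
      ((Inl ` {0..<k} \<union> Inl ` {k..<n}) \<union> (Inr ` {0..<n - k - 1} \<union> Inr ` {n - k - 1..<n - k - 1 + k}))"
    by (intro bij_betw_combine hS hT hX hY) auto
  moreover have "pverts (graph_of B) = (S \<union> T) \<union> ((part1 B - S) \<union> (part2 B - T))"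
    using S T by (auto simp: graph_of_def)
  moreover have "pverts (graph_of (C_graph n k)) =
      (Inl ` {0..<k} \<union> Inl ` {k..<n}) \<union> (Inr ` {0..<n - k - 1} \<union> Inr ` {n - k - 1..<n - k - 1 + k})"
    using k by (simp add: graph_of_def C_graph_def bijoin_def edgeless_bigraph_def
        complete_bigraph_def Plus_def Un_ac)
  ultimately have "bij_betw h (pverts (graph_of B)) (pverts (graph_of (C_graph n k)))"
    by simp
  then have "inj_on h (pverts (graph_of B))"
    and "h ` pverts (graph_of B) \<subseteq> pverts (graph_of (C_graph n k))"
    by (simp_all add: bij_betw_def)
  moreover have edge: "(h x, h y) \<in> bedges (C_graph n k)" if xy: "(x, y) \<in> bedges B" for x y
  proof -
    let ?X1 = "Inl ` {0..<k}" and ?Y1 = "Inl ` {k..<n}" and ?X2 = "Inr ` {0..<n - k - 1}"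
      and ?Y2 = "Inr ` {n - k - 1..<n - k - 1 + k}"
    have "?X2 \<times> ?Y2 \<union> ?X1 \<times> ?Y2 \<union> ?X2 \<times> ?Y1 \<subseteq> bedges (C_graph n k)"
      using k by (auto simp: C_graph_def bijoin_def edgeless_bigraph_def complete_bigraph_def)
    moreover have "x \<in> S \<or> x \<in> part1 B - S" "y \<in> T \<or> y \<in> part2 B - T" "\<not> (x \<in> S \<and> y \<in> T)"
      using xy E ST by auto
    then have "(h x, h y) \<in> ?X2 \<times> ?Y2 \<union> ?X1 \<times> ?Y2 \<union> ?X2 \<times> ?Y1"
      using bij_betwE[OF hS] bij_betwE[OF hT] bij_betwE[OF hX] bij_betwE[OF hY] by blast
    ultimately show ?thesis
      by blast
  qed
  then have "(h u, h v) \<in> parcs (graph_of (C_graph n k))" if "(u, v) \<in> parcs (graph_of B)" for u v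
    using that by (auto simp: graph_of_def)
  ultimately show ?thesis
    by (intro subgraph_up_to_iso_if_embedding pair_graph_graph_of B bipartite_graph_C_graph)
qed

theorem theorem3p11:
  fixes G :: "'a bigraph" and n k :: nat
  assumes "k \<ge> 1"
    and "n \<ge> (k + 1)^2"
    and "bipartite_graph G"
    and "nearly_balanced G"
    and "card (pverts (graph_of G)) = 2 * n - 1"
    and "min_degree (graph_of G) \<ge> k"
    and "signless_laplacian_radius (graph_of G)
           > (real n * (2 * real n - real k - 2) + (real k + 1)^2) / real n"
  shows "traceable (graph_of G) \<or> subgraph_up_to_iso (graph_of G) (graph_of (C_graph n k))"
proof -
  define X Y E where "X = part1 G" and "Y = part2 G" and "E = bedges G"
  have fin: "finite X" "finite Y" and disj: "X \<inter> Y = {}" and E: "E \<subseteq> X \<times> Y"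
    using assms(3) by (auto simp: bipartite_graph_def X_def Y_def E_def)
  have V: "pverts (graph_of G) = X \<union> Y"
    by (simp add: graph_of_def X_def Y_def)
  have "2 * k + 1 \<le> (k + 1)^2"
    by (simp add: power2_eq_square)
  then have n: "2 * k + 1 \<le> n"
    using assms(2) by linarith
  have cards: "card X = n - 1" "card Y = n"
    using assms(4,5) card_Un_disjoint[OF fin disj] n by (auto simp: nearly_balanced_def V X_def Y_def)
  interpret near_balanced_parts X Y
    using fin disj cards n by unfold_locales auto
  have degree: "k \<le> card (parcs (graph_of G) `` {v})" if "v \<in> X \<union> Y" for v
  proof -
    have "min_degree (graph_of G) \<le> out_degree (with_proj (graph_of G)) v"
      unfolding min_degree_def V using that fin by (intro Min_le) auto
    then show ?thesis
      using assms(6) by (simp add: out_degree_with_proj)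
  qed
  have dX: "k \<le> card (E `` {x})" if "x \<in> X" for x
  proof -
    have "parcs (graph_of G) `` {x} = E `` {x}"
      using that E disj by (auto simp: graph_of_def E_def)
    with degree[of x] that show ?thesis
      by simp
  qed
  have dY: "k \<le> card (E\<inverse> `` {y})" if "y \<in> Y" for y
  proof -
    have "parcs (graph_of G) `` {y} = E\<inverse> `` {y}"
      using that E disj by (auto simp: graph_of_def E_def)
    with degree[of y] that show ?thesis
      by simp
  qed
  have "signless_laplacian_radius (graph_of G) \<le> real n + real (card E) / real n"
    unfolding E_def
  proof (rule signless_laplacian_radius_bipartite_le[OF assms(3)])
    show "card (part1 G) \<le> n" "card (part2 G) \<le> n"
      using cards by (auto simp: X_def Y_def)
    show "pverts (graph_of G) \<noteq> {}"
      using cards n unfolding V by auto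
    show "0 < card (parcs (graph_of G) `` {v})" if "v \<in> pverts (graph_of G)" for v
      using degree[of v] that assms(1) unfolding V by simp
  qed
  then have "(real n * (2 * real n - real k - 2) + (real k + 1)^2) / real n
      < real n + real (card E) / real n"
    using assms(7) by linarith
  then have "(real n * (2 * real n - real k - 2) + (real k + 1)^2) / real n
      < (real n * real n + real (card E)) / real n"
    using n by (simp add: add_divide_distrib)
  then have *: "real n * (2 * real n - real k - 2) + (real k + 1)^2 < real n * real n + real (card E)"
    using n by (simp add: divide_less_cancel)
  have "real (n - 1) = real n - 1" "real (n - k - 1) = real n - real k - 1"
    using n by (simp_all add: of_nat_diff)
  with * have "real (card X * card Y) < real (card E + (k + 1) * (n - k - 1))"
    unfolding cards of_nat_mult of_nat_add by (simp add: algebra_simps power2_eq_square)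
  then have dense: "card X * card Y < card E + (k + 1) * (n - k - 1)"
    using of_nat_less_iff by blast
  have "0 < k"
    using assms(1) by simp
  then have "(\<exists>p. spanning_path X Y E p) \<or>
      (\<exists>S T. S \<subseteq> X \<and> T \<subseteq> Y \<and> card S = k \<and> card T = n - k \<and> E \<inter> S \<times> T = {})"
    using dX dY by (intro spanning_path_or_empty_rectangle E cards(2) n dense)
  then show ?thesis
  proof (elim disjE exE conjE)
    fix p assume "spanning_path X Y E p"
    then show ?thesis
      using traceable_if_spanning_path[of G p] by (simp add: X_def Y_def E_def)
  next
    fix S T assume "S \<subseteq> X" "T \<subseteq> Y" "card S = k" "card T = n - k" "E \<inter> S \<times> T = {}"
    then show ?thesis
      using subgraph_of_C_graph[of G n S k T] assms(3) cards n by (simp add: X_def Y_def E_def)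
  qed
qed

end
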